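(* Consider the price-coupling game $\mathcal{T}$ in the price-taking formulation, and suppose it has a potential function $\Pi$. Consider the optimization problem $\mathbb{P}^t$: maximize $\Pi(x,p)$ over $(x,p)\in\mathcal{A}$. Suppose $(x^*,p^* )\in\mathcal{A}$ is a maximizer of $\mathbb{P}^t$ and suppose that for all $i\in\mathcal{N}$, $\Gamma_i(p^*,x^{-i*})=X_i$. Then $(x^*,p^* )$ is an equilibrium of the game $\mathcal{T}$.
   Context: Setting: $\mathcal{N}=\{1,\dots,N\}$ is the set of players; $X_i\subseteq\mathbb{R}^{m_i}$ is the decision set of player $i$; $X=\prod_{i\in\mathcal{N}}X_i$; $x=(x_1,\dots,x_N)\in X$; $x^{-i}=(x_j)_{j\ne i}\in X^{-i}=\prod_{j\ne i}X_j$; one writes $x=(x_i,x^{-i})$. Prices $p$ lie in a Euclidean space $\mathbb{R}^k$. $h:\mathbb{R}^k\times X\to\mathbb{R}$ is common to all players, $g_i:X\to\mathbb{R}$ is specific to player $i$, and $J_i(x,p)=h(p,x)+g_i(x)$. For $x\in X$ the price-determining player minimizes $f(x,p)$ over $p\in\mathcal{M}(x)$, where $f:X\times\mathbb{R}^k\to\mathbb{R}$ and $\mathcal{M}(x)\subseteq\mathbb{R}^k$ for each $x\in X$. Let $\mathcal{A}=\{(x,p) : x\in X,\ p\in\mathcal{M}(x)\}$ and $\Gamma_i(p,x^{-i})=\{x_i : x_i\in X_i,\ p\in\mathcal{M}(x_i,x^{-i})\}$. Game $\mathcal{T}$ (price-taking formulation, an $(N+1)$-player game): given $(p,x^{-i})$,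 player $i$ maximizes $h(p,x)+g_i(x)$ over $x_i\in X_i$; given $x$, the price-determining player minimizes $f(x,p)$ over $p\in\mathcal{M}(x)$. A point $(x^*,p^* )\in\mathcal{A}$ is an equilibrium of $\mathcal{T}$ if for all $i\in\mathcal{N}$, $h(p^*,x^* )+g_i(x^* )\ge h(p^*,x_i,x^{-i*})+g_i(x_i,x^{-i*})$ for all $x_i\in X_i$, and $f(x^*,p^* )\le f(x^*,p)$ for all $p\in\mathcal{M}(x^* )$. A function $\Pi:X\times\mathbb{R}^k\to\mathbb{R}$ is a potential function of the game if for all $i\in\mathcal{N}$, $\Pi(\tilde x_i,x^{-i},p)-\Pi(\hat x_i,x^{-i},p)=J_i(\tilde x_i,x^{-i},p)-J_i(\hat x_i,x^{-i},p)$ for all $\tilde x_i,\hat x_i\in X_i$, $x^{-i}\in X^{-i}$, $p\in\mathbb{R}^k$, and $\Pi(x,\tilde p)-\Pi(x,\hat p)=-f(x,\tilde p)+f(x,\hat p)$ for all $x\in X$, $\tilde p,\hat p\in\mathbb{R}^k$. *)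

theory Defs
  imports "HOL-Analysis.Analysis"
begin

text \<open>
  The decision sets live in Euclidean spaces whose dimension depends on the player, so vectors of
  \<open>\<real>\<^sup>n\<close> are the points of the library space \<^const>\<open>Euclidean_space\<close>: functions
  \<open>nat \<Rightarrow> real\<close> vanishing at all indices \<open>\<ge> n\<close>. A profile assigns a vector to each
  player; outside the player set it is \<^const>\<open>undefined\<close> (membership in \<^const>\<open>PiE\<close>).
\<close>

type_synonym profile = "nat \<Rightarrow> nat \<Rightarrow> real"

record 'k price_coupling_game =
  num_players :: nat
  dims :: "nat \<Rightarrow> nat"
  decision_set :: "nat \<Rightarrow> (nat \<Rightarrow> real) set"
  common_payoff :: "real ^ 'k \<Rightarrow> profile \<Rightarrow> real"
  own_payoff :: "nat \<Rightarrow> profile \<Rightarrow> real"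
  price_objective :: "profile \<Rightarrow> real ^ 'k \<Rightarrow> real"
  feasible_prices :: "profile \<Rightarrow> (real ^ 'k) set"

definition players :: "'k::finite price_coupling_game \<Rightarrow> nat set" where
  "players G = {1..num_players G}"

definition is_game :: "'k::finite price_coupling_game \<Rightarrow> bool" where
  "is_game G \<longleftrightarrow>
     (\<forall>i\<in>players G. decision_set G i \<subseteq> topspace (Euclidean_space (dims G i)))"

definition profiles :: "'k::finite price_coupling_game \<Rightarrow> profile set" where
  "profiles G = PiE (players G) (decision_set G)"

definition profiles_except :: "'k::finite price_coupling_game \<Rightarrow> nat \<Rightarrow> profile set" where
  "profiles_except G i = PiE (players G - {i}) (decision_set G)"

definition others :: "'k::finite price_coupling_game \<Rightarrow> nat \<Rightarrow> profile \<Rightarrow> profile" where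
  "others G i x = restrict x (players G - {i})"

text \<open>\<open>join i a z\<close> is the profile written $(a, z)$ with \<open>a\<close> the decision of player \<open>i\<close>.\<close>

definition join :: "nat \<Rightarrow> (nat \<Rightarrow> real) \<Rightarrow> profile \<Rightarrow> profile" where
  "join i a z = z(i := a)"

definition payoff ::
  "'k::finite price_coupling_game \<Rightarrow> nat \<Rightarrow> profile \<Rightarrow> real ^ 'k \<Rightarrow> real" where
  "payoff G i x p = common_payoff G p x + own_payoff G i x"

definition feasible_pairs :: "'k::finite price_coupling_game \<Rightarrow> (profile \<times> (real ^ 'k)) set" where
  "feasible_pairs G = {(x, p). x \<in> profiles G \<and> p \<in> feasible_prices G x}"

definition compatible_decisions ::
  "'k::finite price_coupling_game \<Rightarrow> nat \<Rightarrow> real ^ 'k \<Rightarrow> profile \<Rightarrow> (nat \<Rightarrow> real) set" where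
  "compatible_decisions G i p z =
     {a. a \<in> decision_set G i \<and> p \<in> feasible_prices G (join i a z)}"

definition equilibrium ::
  "'k::finite price_coupling_game \<Rightarrow> profile \<Rightarrow> real ^ 'k \<Rightarrow> bool" where
  "equilibrium G x p \<longleftrightarrow>
     (x, p) \<in> feasible_pairs G \<and>
     (\<forall>i\<in>players G. \<forall>a\<in>decision_set G i.
        common_payoff G p x + own_payoff G i x \<ge>
        common_payoff G p (join i a (others G i x)) + own_payoff G i (join i a (others G i x))) \<and>
     (\<forall>q\<in>feasible_prices G x. price_objective G x p \<le> price_objective G x q)"

definition potential_function ::
  "'k::finite price_coupling_game \<Rightarrow> (profile \<Rightarrow> real ^ 'k \<Rightarrow> real) \<Rightarrow> bool" where
  "potential_function G \<Phi> \<longleftrightarrow>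
     (\<forall>i\<in>players G. \<forall>a\<in>decision_set G i. \<forall>b\<in>decision_set G i. \<forall>z\<in>profiles_except G i. \<forall>p.
        \<Phi> (join i a z) p - \<Phi> (join i b z) p =
        payoff G i (join i a z) p - payoff G i (join i b z) p) \<and>
     (\<forall>x\<in>profiles G. \<forall>p q.
        \<Phi> x p - \<Phi> x q = - price_objective G x p + price_objective G x q)"

end

theory Submission
  imports Defs
begin

text \<open>
  A maximizer of the potential cannot be improved within the feasible pairs, and along a move of a
  single decision maker the potential varies exactly as the objective of that decision maker
  (negated for the price-determining player). Hence no unilateral move that stays feasible is
  profitable. Price moves stay feasible by definition. A move of player \<open>i\<close> changes the
  profile, and with it the set of admissible prices, so an arbitrary move could leave the feasible
  pairs; this is ruled out by the hypothesis that all decisions of \<open>i\<close> are compatible with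
  the given price. Thus optimality over the feasible pairs covers every deviation.
\<close>

lemma join_own_decision_others:
  assumes "x \<in> profiles G" and "i \<in> players G"
  shows "join i (x i) (others G i x) = x"
  using assms by (auto simp: join_def others_def profiles_def PiE_def extensional_def fun_eq_iff)

lemma others_in_profiles_except:
  assumes "x \<in> profiles G"
  shows "others G i x \<in> profiles_except G i"
  using assms by (auto simp: others_def profiles_def profiles_except_def)

lemma join_in_profiles:
  assumes "z \<in> profiles_except G i" and "i \<in> players G" and "a \<in> decision_set G i"
  shows "join i a z \<in> profiles G"
  using assms
  by (auto simp: join_def profiles_def profiles_except_def PiE_def extensional_def Pi_def)

theorem mainTheorem4:
  fixes G :: "'k::finite price_coupling_game"
    and \<Phi> :: "profile \<Rightarrow> real ^ 'k \<Rightarrow> real"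
    and x :: profile and p :: "real ^ 'k"
  assumes "is_game G"
    and "potential_function G \<Phi>"
    and "is_arg_max (\<lambda>(y, q). \<Phi> y q) (\<lambda>z. z \<in> feasible_pairs G) (x, p)"
    and "\<forall>i\<in>players G. compatible_decisions G i p (others G i x) = decision_set G i"
  shows "equilibrium G x p"
proof -
  have feasible: "(x, p) \<in> feasible_pairs G"
    using assms(3) by (simp add: is_arg_max_def)
  then have x: "x \<in> profiles G"
    by (simp add: feasible_pairs_def)
  have maximal: "\<Phi> y q \<le> \<Phi> x p" if "(y, q) \<in> feasible_pairs G" for y q
    using assms(3) that by (force simp: is_arg_max_def not_less)
  have "payoff G i (join i a (others G i x)) p \<le> payoff G i x p"
    if i: "i \<in> players G" and a: "a \<in> decision_set G i" for i a
  proof -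
    let ?z = "others G i x"
    have z: "?z \<in> profiles_except G i"
      using x by (rule others_in_profiles_except)
    have "x i \<in> decision_set G i"
      using x i by (auto simp: profiles_def)
    then have "\<Phi> (join i a ?z) p - \<Phi> (join i (x i) ?z) p =
        payoff G i (join i a ?z) p - payoff G i (join i (x i) ?z) p"
      using assms(2) i a z unfolding potential_function_def by blast
    then have same_gain: "\<Phi> (join i a ?z) p - \<Phi> x p = payoff G i (join i a ?z) p - payoff G i x p"
      by (simp add: join_own_decision_others[OF x i])
    have "a \<in> compatible_decisions G i p ?z"
      using assms(4) i a by simp
    then have "(join i a ?z, p) \<in> feasible_pairs G"
      using join_in_profiles[OF z i a]
      by (simp add: feasible_pairs_def compatible_decisions_def)
    from maximal[OF this] same_gain show ?thesis
      by linarith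
  qed
  moreover have "price_objective G x p \<le> price_objective G x q"
    if q: "q \<in> feasible_prices G x" for q
  proof -
    have "(x, q) \<in> feasible_pairs G"
      using x q by (simp add: feasible_pairs_def)
    from maximal[OF this] have "\<Phi> x q \<le> \<Phi> x p" .
    moreover have "\<Phi> x p - \<Phi> x q = - price_objective G x p + price_objective G x q"
      using assms(2) x unfolding potential_function_def by blast
    ultimately show ?thesis
      by linarith
  qed
  ultimately show ?thesis
    using feasible by (simp add: equilibrium_def payoff_def)
qed

end
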